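(* Let $F\in\mathcal{H}^d$ and $A=\mathcal{A}(F)$. If $\rho(A)<1$, then there exists $\mathbf{b}\in\mathbb{R}^d_{++}$ with $A^T\mathbf{b}\le r\mathbf{b}$ for some $r\in[\rho(A),1)$, and there exists a unique $\mathbf{u}\in\mathcal{S}_{++}$ such that $F(\mathbf{u})=\boldsymbol{\lambda}\otimes\mathbf{u}$ for some $\boldsymbol{\lambda}\in\mathbb{R}^d_{++}$. For $\mathbf{x}^0\in\mathcal{S}_{++}$, let $$\mathbf{x}^k=\left(\frac{F_1(\mathbf{x}^{k-1})}{\|F_1(\mathbf{x}^{k-1})\|_{\gamma_1}},\ldots,\frac{F_d(\mathbf{x}^{k-1})}{\|F_d(\mathbf{x}^{k-1})\|_{\gamma_d}}\right)\qquad\forall k\in\mathbb{N}.$$ Then $$\lim_{j\to\infty}\mathbf{x}^j=\mathbf{u}\qquad\text{and}\qquad \mu_{\mathbf{b}}(\mathbf{u},\mathbf{x}^k)\le\frac{r^k}{1-r}\,\mu_{\mathbf{b}}(\mathbf{x}^1,\mathbf{x}^0)\qquad\forall k\in\mathbb{N},$$ where $\mu_{\mathbf{b}}\colon\mathcal{K}_{++}\times\mathcal{K}_{++}\to\mathbb{R}_+$ is defined by $$\mu_{\mathbf{b}}(\mathbf{x},\mathbf{y})=\sum_{i=1}^d b_i\ln\left[\Big(\max_{j_i\in[n_i]}\frac{x_{i,j_i}}{y_{i,j_i}}\Big)\Big(\max_{l_i\in[n_i]}\frac{y_{i,l_i}}{x_{i,l_i}}\Big)\right].$$ In particular, if $A$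 has a positive left-eigenvector $\mathbf{c}\in\mathbb{R}^d_{++}$, then one can choose $\mathbf{b}=\mathbf{c}$ so that $r=\rho(A)$.
   Context: $\mathbb{N}=\{1,2,\ldots\}$ and $[n]=\{1,\ldots,n\}$. Fix $d,n_1,\ldots,n_d\in\mathbb{N}$. Let $\mathcal{K}_+=\mathbb{R}^{n_1}_+\times\cdots\times\mathbb{R}^{n_d}_+$ (vectors with nonnegative entries) and $\mathcal{K}_{++}=\mathbb{R}^{n_1}_{++}\times\cdots\times\mathbb{R}^{n_d}_{++}$ (vectors with positive entries). Write $\mathbf{x}=(\mathbf{x}_1,\ldots,\mathbf{x}_d)$, $\mathbf{x}_i=(x_{i,1},\ldots,x_{i,n_i})$, and $F=(F_1,\ldots,F_d)$ for the blocks of a map $F$. $\mathbf{x}\le\mathbf{y}$ means $\mathbf{y}-\mathbf{x}$ has nonnegative entries. For $\boldsymbol{\alpha}\in\mathbb{R}^d$, $\boldsymbol{\alpha}\otimes\mathbf{x}=(\alpha_1\mathbf{x}_1,\ldots,\alpha_d\mathbf{x}_d)$. For $\boldsymbol{\alpha}\in\mathbb{R}^d_{++}$ and $B\in\mathbb{R}^{d\times d}$, $\boldsymbol{\alpha}^B=(\prod_{k}\alpha_k^{B_{1,k}},\ldots,\prod_k\alpha_k^{B_{d,k}})$. $\mathbf{1}$ is the vector of all ones, $\rho$ the spectral radius. $F\colon\mathcal{K}_+\to\mathcal{K}_+$ is order-preserving if $\mathbf{x}\le\mathbf{y}$ implies $F(\mathbf{x})\le F(\mathbf{y})$; it is multi-homogeneous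 with homogeneity matrix $\mathcal{A}(F)=A\in\mathbb{R}^{d\times d}$ if $F(\boldsymbol{\alpha}\otimes\mathbf{x})=\boldsymbol{\alpha}^A\otimes F(\mathbf{x})$ for all $\mathbf{x}\in\mathcal{K}_+$, $\boldsymbol{\alpha}\in\mathbb{R}^d_{++}$. $\mathcal{H}^d$ is the set of $F\colon\mathcal{K}_+\to\mathcal{K}_+$ that are continuous, order-preserving and multi-homogeneous, with $F(\mathbf{1})\in\mathcal{K}_{++}$ and such that $\mathcal{A}(F)$ has at least one nonzero entry per row. For each $i\in[d]$, $\|\cdot\|_{\gamma_i}$ is a norm on $\mathbb{R}^{n_i}$, assumed monotonic: $0\le\mathbf{x}_i\le\mathbf{y}_i$ implies $\|\mathbf{x}_i\|_{\gamma_i}\le\|\mathbf{y}_i\|_{\gamma_i}$. $\mathcal{S}_{++}=\{\mathbf{x}\in\mathcal{K}_{++}:\|\mathbf{x}_i\|_{\gamma_i}=1\ \forall i\in[d]\}$. *)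

theory Defs
  imports "Jordan_Normal_Form.Spectral_Radius" "HOL-Analysis.Function_Topology"
begin

text \<open>
  Indices are 0-based: blocks are \<open>i < d\<close>, and the entries of block \<open>i\<close> are \<open>j < n i\<close>.
  A vector of length \<open>m\<close> is a function on \<^typ>\<open>nat\<close> vanishing from \<open>m\<close> on (the convention of the
  library's \<open>Euclidean_space\<close>), so a block vector is a function vanishing outside its index set.
  With this convention the order \<open>\<le>\<close> on functions is the entrywise order, and the product topology
  of \<open>HOL-Analysis.Function_Topology\<close> induces the Euclidean topology.
  Elements of $R^d$ and $R^{d \times d}$ are vectors and matrices of \<open>Jordan_Normal_Form\<close>.
\<close>

type_synonym bvec = "nat \<Rightarrow> nat \<Rightarrow> real"

definition Rn :: "nat \<Rightarrow> (nat \<Rightarrow> real) set" where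
  "Rn m = {v. \<forall>j\<ge>m. v j = 0}"

definition block_space :: "nat \<Rightarrow> (nat \<Rightarrow> nat) \<Rightarrow> bvec set" where
  "block_space d n = {x. (\<forall>i<d. x i \<in> Rn (n i)) \<and> (\<forall>i\<ge>d. \<forall>j. x i j = 0)}"

definition K_plus :: "nat \<Rightarrow> (nat \<Rightarrow> nat) \<Rightarrow> bvec set" where
  "K_plus d n = {x \<in> block_space d n. \<forall>i<d. \<forall>j<n i. 0 \<le> x i j}"

definition K_pos :: "nat \<Rightarrow> (nat \<Rightarrow> nat) \<Rightarrow> bvec set" where
  "K_pos d n = {x \<in> block_space d n. \<forall>i<d. \<forall>j<n i. 0 < x i j}"

definition R_pos :: "nat \<Rightarrow> real vec set" where
  "R_pos d = {a \<in> carrier_vec d. \<forall>i<d. 0 < a $ i}"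

definition block_one :: "nat \<Rightarrow> (nat \<Rightarrow> nat) \<Rightarrow> bvec" where
  "block_one d n = (\<lambda>i j. if i < d \<and> j < n i then 1 else 0)"

definition block_scale :: "real vec \<Rightarrow> bvec \<Rightarrow> bvec" where
  "block_scale a x = (\<lambda>i j. if i < dim_vec a then a $ i * x i j else 0)"

definition vec_powr :: "real vec \<Rightarrow> real mat \<Rightarrow> real vec" where
  "vec_powr a B = vec (dim_row B) (\<lambda>i. \<Prod>k<dim_col B. (a $ k) powr (B $$ (i, k)))"

text \<open>If \<open>F\<close> maps the all-ones vector into the positive cone, such a matrix is unique.\<close>

definition homogeneity_matrix :: "nat \<Rightarrow> (nat \<Rightarrow> nat) \<Rightarrow> (bvec \<Rightarrow> bvec) \<Rightarrow> real mat \<Rightarrow> bool" where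
  "homogeneity_matrix d n F A \<longleftrightarrow> A \<in> carrier_mat d d \<and>
     (\<forall>x\<in>K_plus d n. \<forall>a\<in>R_pos d. F (block_scale a x) = block_scale (vec_powr a A) (F x))"

definition Hd :: "nat \<Rightarrow> (nat \<Rightarrow> nat) \<Rightarrow> (bvec \<Rightarrow> bvec) set" where
  "Hd d n = {F. F \<in> K_plus d n \<rightarrow> K_plus d n \<and> continuous_on (K_plus d n) F \<and>
     mono_on (K_plus d n) F \<and> F (block_one d n) \<in> K_pos d n \<and>
     (\<exists>A. homogeneity_matrix d n F A \<and> (\<forall>i<d. \<exists>k<d. A $$ (i, k) \<noteq> 0))}"

definition norm_on_Rn :: "nat \<Rightarrow> ((nat \<Rightarrow> real) \<Rightarrow> real) \<Rightarrow> bool" where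
  "norm_on_Rn m N \<longleftrightarrow>
     (\<forall>v\<in>Rn m. 0 \<le> N v \<and> (N v = 0 \<longleftrightarrow> (\<forall>j<m. v j = 0))) \<and>
     (\<forall>v\<in>Rn m. \<forall>c. N (\<lambda>j. c * v j) = \<bar>c\<bar> * N v) \<and>
     (\<forall>v\<in>Rn m. \<forall>w\<in>Rn m. N (\<lambda>j. v j + w j) \<le> N v + N w)"

definition monotonic_norm :: "nat \<Rightarrow> ((nat \<Rightarrow> real) \<Rightarrow> real) \<Rightarrow> bool" where
  "monotonic_norm m N \<longleftrightarrow> norm_on_Rn m N \<and> mono_on {v \<in> Rn m. \<forall>j<m. 0 \<le> v j} N"

definition S_pos :: "nat \<Rightarrow> (nat \<Rightarrow> nat) \<Rightarrow> (nat \<Rightarrow> (nat \<Rightarrow> real) \<Rightarrow> real) \<Rightarrow> bvec set" where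
  "S_pos d n \<gamma> = {x \<in> K_pos d n. \<forall>i<d. \<gamma> i (x i) = 1}"

definition block_normalize :: "(nat \<Rightarrow> (nat \<Rightarrow> real) \<Rightarrow> real) \<Rightarrow> bvec \<Rightarrow> bvec" where
  "block_normalize \<gamma> y = (\<lambda>i j. y i j / \<gamma> i (y i))"

definition mu :: "nat \<Rightarrow> (nat \<Rightarrow> nat) \<Rightarrow> real vec \<Rightarrow> bvec \<Rightarrow> bvec \<Rightarrow> real" where
  "mu d n b x y = (\<Sum>i<d. b $ i *
     ln (Max ((\<lambda>j. x i j / y i j) ` {..<n i}) * Max ((\<lambda>l. y i l / x i l) ` {..<n i})))"

definition rho :: "real mat \<Rightarrow> real" where
  "rho A = spectral_radius (map_mat complex_of_real A)"

definition admissible_weight :: "nat \<Rightarrow> real mat \<Rightarrow> real vec \<Rightarrow> real \<Rightarrow> bool" where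
  "admissible_weight d A b r \<longleftrightarrow>
     b \<in> R_pos d \<and> r \<in> {rho A..<1} \<and> transpose_mat A *\<^sub>v b \<le> r \<cdot>\<^sub>v b"

definition normalized_eigenvector ::
  "nat \<Rightarrow> (nat \<Rightarrow> nat) \<Rightarrow> (nat \<Rightarrow> (nat \<Rightarrow> real) \<Rightarrow> real) \<Rightarrow> (bvec \<Rightarrow> bvec) \<Rightarrow> bvec \<Rightarrow> bool" where
  "normalized_eigenvector d n \<gamma> F u \<longleftrightarrow>
     u \<in> S_pos d n \<gamma> \<and> (\<exists>l\<in>R_pos d. F u = block_scale l u)"

end

theory Submission
  imports Defs
begin

text \<open>
  The statement is Banach's fixed point theorem for Hilbert's projective metric. If \<open>M\<^sub>k\<close> is the least
  number with \<open>x\<^sub>k \<le> M\<^sub>k y\<^sub>k\<close> for each block \<open>k\<close>, then \<open>x \<le> M \<otimes> y\<close>, and since \<open>F\<close> preserves the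
  order and is multi-homogeneous, \<open>F x \<le> M\<^sup>A \<otimes> F y\<close>. In logarithms this reads: the vector of Hilbert
  distances between the blocks of \<open>F x\<close> and \<open>F y\<close> is at most \<open>A\<close> times the vector of distances between
  the blocks of \<open>x\<close> and \<open>y\<close> (lemma \<open>hilbert_dist_F_le\<close>). Normalizing the blocks does not change
  these distances. If \<open>b > 0\<close> and the transpose of \<open>A\<close> maps \<open>b\<close> below \<open>r b\<close>, the \<open>b\<close>-weighted sum
  \<open>mu\<close> of the block distances therefore contracts by the factor \<open>r < 1\<close> (lemma
  \<open>mu_normalized_map_le\<close>).

  Such a \<open>b\<close> exists because \<open>A\<close> is nonnegative, as monotonicity of \<open>F\<close> forces, and has spectral
  radius below one: the column sums of a sufficiently long partial sum of the Neumann series of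
  \<open>A / r\<close> will do (lemma \<open>ex_admissible_weight\<close>). A positive left eigenvector
  belongs to the eigenvalue \<open>rho A\<close>, so it is a weight with \<open>r = rho A\<close> (lemma
  \<open>rho_eq_positive_left_eigenvector\<close>).

  For vectors whose blocks have norm one, monotonicity of the norms makes both maximal ratios of a
  block at least one, so \<open>mu\<close> bounds the differences of the logarithms of the entries
  (lemma \<open>ln_diff_le_hilbert_dist\<close>). Hence convergence in \<open>mu\<close> is entrywise convergence, the
  logarithms of the iterates converge like a geometric series, and their limit is a positive fixed
  point of the normalized map (lemma \<open>ex_fixed_point\<close>). The error bound and uniqueness follow from
  the contraction as usual.
\<close>

text \<open>The topology on functions is the product topology. Used twice, this turns convergence of block
  vectors into convergence of every entry.\<close>

lemma tendsto_fun_iff: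
  fixes f :: "'a \<Rightarrow> 'i \<Rightarrow> 'b::topological_space"
  shows "(f \<longlongrightarrow> l) G \<longleftrightarrow> (\<forall>i. ((\<lambda>c. f c i) \<longlongrightarrow> l i) G)"
proof -
  have "(f \<longlongrightarrow> l) G \<longleftrightarrow> limitin (product_topology (\<lambda>_. euclidean) UNIV) f l G"
    by (simp add: euclidean_product_topology)
  also have "\<dots> \<longleftrightarrow> (\<forall>i. ((\<lambda>c. f c i) \<longlongrightarrow> l i) G)"
    by (subst limitin_componentwise) simp
  finally show ?thesis .
qed

section \<open>The spectral radius of a nonnegative matrix and its weights\<close>

lemma rho_attained:
  assumes "A \<in> carrier_mat d d" and "0 < d"
  obtains ev v where "v \<in> carrier_vec d" "v \<noteq> 0\<^sub>v d"
    "map_mat complex_of_real A *\<^sub>v v = ev \<cdot>\<^sub>v v" "rho A = cmod ev"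
proof -
  let ?C = "map_mat complex_of_real A"
  have C: "?C \<in> carrier_mat d d" using assms by simp
  obtain ev where ev: "ev \<in> spectrum ?C" "rho A = cmod ev"
    using spectral_radius_mem_max(1)[OF C assms(2)] by (auto simp: rho_def)
  then show ?thesis
    using that C unfolding spectrum_def eigenvalue_def eigenvector_def by auto
qed

lemma rho_nonneg: "A \<in> carrier_mat d d \<Longrightarrow> 0 < d \<Longrightarrow> 0 \<le> rho A"
  by (erule rho_attained) auto

lemma cmod_eigenvalue_le_rho:
  assumes "A \<in> carrier_mat d d" and "0 < d" and "v \<in> carrier_vec d" "v \<noteq> 0\<^sub>v d"
    and "map_mat complex_of_real A *\<^sub>v v = ev \<cdot>\<^sub>v v"
  shows "cmod ev \<le> rho A"
proof -
  let ?C = "map_mat complex_of_real A"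
  have C: "?C \<in> carrier_mat d d" using assms by simp
  have "ev \<in> spectrum ?C"
    using assms C unfolding spectrum_def eigenvalue_def eigenvector_def by auto
  then show ?thesis
    using spectral_radius_mem_max(2)[OF C assms(2)] by (auto simp: rho_def)
qed

lemma pow_smult_mat:
  fixes a :: "'a::comm_semiring_1"
  assumes "A \<in> carrier_mat d d"
  shows "(a \<cdot>\<^sub>m A) ^\<^sub>m k = a ^ k \<cdot>\<^sub>m (A ^\<^sub>m k)"
proof (induction k)
  case 0
  show ?case using assms by (auto intro!: eq_matI)
next
  case (Suc k)
  have P: "A ^\<^sub>m k \<in> carrier_mat d d" using assms by simp
  have "(a \<cdot>\<^sub>m A) ^\<^sub>m Suc k = (a ^ k \<cdot>\<^sub>m (A ^\<^sub>m k)) * (a \<cdot>\<^sub>m A)"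
    by (simp add: Suc.IH)
  also have "\<dots> = a ^ k \<cdot>\<^sub>m (a \<cdot>\<^sub>m (A ^\<^sub>m k * A))"
    using mult_smult_assoc_mat[OF P smult_carrier_mat[OF assms]] mult_smult_distrib[OF P assms]
    by simp
  also have "\<dots> = a ^ Suc k \<cdot>\<^sub>m (A ^\<^sub>m Suc k)"
    by (auto intro!: eq_matI simp: algebra_simps)
  finally show ?case .
qed

text \<open>The spectral radius of \<open>A / s\<close> is below \<open>1\<close>, so by the Jordan normal form the entries of its
  powers stay bounded; multiplying by \<open>s ^ k\<close> gives the bound for \<open>A\<close>.\<close>

lemma mat_pow_entries_le:
  assumes A: "A \<in> carrier_mat d d" and d: "0 < d" and s: "rho A < s"
  shows "\<exists>c. \<forall>k. \<forall>i<d. \<forall>j<d. \<bar>(A ^\<^sub>m k) $$ (i, j)\<bar> \<le> c * s ^ k"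
proof -
  let ?C = "map_mat complex_of_real A"
  let ?B = "complex_of_real (1 / s) \<cdot>\<^sub>m ?C"
  have C: "?C \<in> carrier_mat d d" and B: "?B \<in> carrier_mat d d" using A by simp_all
  have s0: "0 < s" using rho_nonneg[OF A d] s by simp
  have "spectral_radius ?B < 1"
  proof -
    obtain ev where ev: "ev \<in> spectrum ?B" "spectral_radius ?B = cmod ev"
      using spectral_radius_mem_max(1)[OF B d] by auto
    then obtain v where v: "v \<in> carrier_vec d" "v \<noteq> 0\<^sub>v d" and Bv: "?B *\<^sub>v v = ev \<cdot>\<^sub>v v"
      using B unfolding spectrum_def eigenvalue_def eigenvector_def by auto
    have "?C *\<^sub>v v = (of_real s * ev) \<cdot>\<^sub>v v"
    proof (rule eq_vecI)
      fix i assume i: "i < dim_vec ((of_real s * ev) \<cdot>\<^sub>v v)"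
      then have id: "i < d" using v by simp
      have "(?B *\<^sub>v v) $ i = complex_of_real (1 / s) * (?C *\<^sub>v v) $ i"
        using id C v by (simp add: row_smult)
      then have "(?C *\<^sub>v v) $ i = of_real s * (?B *\<^sub>v v) $ i"
        using s0 by simp
      then show "(?C *\<^sub>v v) $ i = ((of_real s * ev) \<cdot>\<^sub>v v) $ i"
        unfolding Bv using id v by simp
    qed (use C v in auto)
    from cmod_eigenvalue_le_rho[OF A d v this] have "s * cmod ev \<le> rho A"
      using s0 by (simp add: norm_mult)
    with s have "s * cmod ev < s * 1" by simp
    then show ?thesis unfolding ev(2) mult_less_cancel_left_pos[OF s0] .
  qed
  from spectral_radius_jnf_norm_bound_less_1_upper_triangular[OF B this]
  obtain c where c: "\<And>k. norm_bound (?B ^\<^sub>m k) c" by auto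
  have bound: "\<bar>(A ^\<^sub>m k) $$ (i, j)\<bar> \<le> c * s ^ k" if ij: "i < d" "j < d" for k i j
  proof -
    have "?B ^\<^sub>m k = complex_of_real (1 / s) ^ k \<cdot>\<^sub>m map_mat complex_of_real (A ^\<^sub>m k)"
      using pow_smult_mat[OF C] of_real_hom.mat_hom_pow[OF A] by metis
    then have "(?B ^\<^sub>m k) $$ (i, j) = complex_of_real (1 / s) ^ k * of_real ((A ^\<^sub>m k) $$ (i, j))"
      using A ij by simp
    then have "cmod ((?B ^\<^sub>m k) $$ (i, j)) = \<bar>(A ^\<^sub>m k) $$ (i, j)\<bar> / s ^ k"
      using s0 by (simp add: norm_mult norm_power norm_divide power_divide)
    moreover have "cmod ((?B ^\<^sub>m k) $$ (i, j)) \<le> c"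
      using c[of k] ij unfolding norm_bound_def carrier_matD[OF pow_carrier_mat[OF B]] by blast
    ultimately show ?thesis using s0 by (simp add: divide_le_eq)
  qed
  then show ?thesis by blast
qed

lemma admissible_weightI:
  assumes "A \<in> carrier_mat d d" and "b \<in> R_pos d" and "rho A \<le> r" "r < 1"
    and "\<And>l. l < d \<Longrightarrow> (\<Sum>i<d. b $ i * A $$ (i, l)) \<le> r * b $ l"
  shows "admissible_weight d A b r"
  using assms unfolding admissible_weight_def R_pos_def less_eq_vec_def
  by (auto simp: scalar_prod_def atLeast0LessThan mult.commute)

lemma admissible_weightD:
  assumes "A \<in> carrier_mat d d" and "admissible_weight d A b r" and "l < d"
  shows "(\<Sum>i<d. b $ i * A $$ (i, l)) \<le> r * b $ l"
  using assms unfolding admissible_weight_def R_pos_def less_eq_vec_def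
  by (auto simp: scalar_prod_def atLeast0LessThan mult.commute)

text \<open>Take \<open>rho A < s < r < 1\<close> and let \<open>q\<^sub>k\<close> be the vector of the column sums of \<open>(A / r)^k\<close>. Its
  entries are nonnegative, \<open>q\<^sub>0\<close> is the all-ones vector, and the transpose of \<open>A\<close> maps \<open>q\<^sub>k\<close> to
  \<open>r q\<^sub>k\<^sub>+\<^sub>1\<close>. For the truncated Neumann series \<open>b = q\<^sub>0 + ... + q\<^sub>N\<^sub>-\<^sub>1\<close> the image of \<open>b\<close> is
  therefore \<open>r (b + q\<^sub>N - q\<^sub>0)\<close>, which is at most \<open>r b\<close> as soon as all entries of \<open>q\<^sub>N\<close> are at
  most \<open>1\<close>. That happens for large \<open>N\<close>, because the entries of \<open>A^N\<close> are \<open>O(s^N)\<close>. Truncating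
  the series avoids any question of convergence.\<close>

lemma ex_admissible_weight:
  assumes A: "A \<in> carrier_mat d d" and d: "0 < d" and rho: "rho A < 1"
    and nonneg: "\<And>i k. i < d \<Longrightarrow> k < d \<Longrightarrow> 0 \<le> A $$ (i, k)"
  shows "\<exists>b r. admissible_weight d A b r"
proof -
  \<comment> \<open>The two points that cut the interval from \<open>rho A\<close> to \<open>1\<close> into thirds.\<close>
  define s where "s = (2 * rho A + 1) / 3"
  define r where "r = (rho A + 2) / 3"
  have order: "rho A < s" "s < r" "r < 1" "0 < s" "0 < r"
    using rho rho_nonneg[OF A d] by (auto simp: s_def r_def)
  obtain c where c: "\<And>k i j. i < d \<Longrightarrow> j < d \<Longrightarrow> \<bar>(A ^\<^sub>m k) $$ (i, j)\<bar> \<le> c * s ^ k"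
    using mat_pow_entries_le[OF A d order(1)] by blast
  have P: "A ^\<^sub>m k \<in> carrier_mat d d" for k using A by simp
  have pow_nonneg: "0 \<le> (A ^\<^sub>m k) $$ (i, j)" if "i < d" "j < d" for k i j
    using that
  proof (induction k arbitrary: i j)
    case 0 then show ?case using A by simp
  next
    case (Suc k)
    then show ?case using A P[of k] nonneg
      by (auto simp: scalar_prod_def intro!: sum_nonneg mult_nonneg_nonneg)
  qed
  define q where "q = (\<lambda>k l. (\<Sum>i<d. (A ^\<^sub>m k) $$ (i, l)) / r ^ k)"
  have q_nonneg: "0 \<le> q k l" if "l < d" for k l
    using that pow_nonneg order by (auto simp: q_def intro!: divide_nonneg_nonneg sum_nonneg)
  have q0: "q 0 l = 1" if "l < d" for l
    using that A by (simp add: q_def)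
  have q_Suc: "(\<Sum>j<d. q k j * A $$ (j, l)) = r * q (Suc k) l" if l: "l < d" for k l
  proof -
    have "(\<Sum>i<d. (A ^\<^sub>m Suc k) $$ (i, l)) = (\<Sum>i<d. \<Sum>j<d. (A ^\<^sub>m k) $$ (i, j) * A $$ (j, l))"
      using l A P[of k] by (intro sum.cong) (auto simp: scalar_prod_def atLeast0LessThan)
    also have "\<dots> = (\<Sum>j<d. (\<Sum>i<d. (A ^\<^sub>m k) $$ (i, j)) * A $$ (j, l))"
      by (subst sum.swap) (simp add: sum_distrib_right)
    finally show ?thesis using order
      by (simp add: q_def sum_divide_distrib[symmetric] del: pow_mat.simps)
  qed
  have "(\<lambda>k. real d * c * (s / r) ^ k) \<longlonglongrightarrow> real d * c * 0"
    using order by (intro tendsto_intros LIMSEQ_power_zero) auto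
  then have "\<forall>\<^sub>F k in sequentially. real d * c * (s / r) ^ k < 1"
    by (intro order_tendstoD(2)) auto
  then obtain N where N: "real d * c * (s / r) ^ N < 1" and N0: "1 \<le> N"
    using eventually_conj[OF _ eventually_ge_at_top[of 1]]
    by (metis (mono_tags, lifting) eventually_happens' sequentially_bot)
  have qN: "q N l \<le> 1" if l: "l < d" for l
  proof -
    have "(\<Sum>i<d. (A ^\<^sub>m N) $$ (i, l)) \<le> (\<Sum>i<d. c * s ^ N)"
      using c[OF _ l] by (intro sum_mono) (meson abs_le_D1 lessThan_iff)
    then have "q N l \<le> real d * (c * s ^ N) / r ^ N"
      using order by (simp add: q_def divide_right_mono)
    with N show ?thesis by (simp add: power_divide)
  qed
  define b where "b = vec d (\<lambda>l. \<Sum>k<N. q k l)"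
  have b_pos: "b \<in> R_pos d"
  proof -
    have "0 < (\<Sum>k<N. q k l)" if "l < d" for l
      using that N0 q_nonneg q0 by (intro sum_pos2[of _ 0]) auto
    then show ?thesis by (simp add: b_def R_pos_def)
  qed
  have "(\<Sum>j<d. b $ j * A $$ (j, l)) \<le> r * b $ l" if l: "l < d" for l
  proof -
    have "(\<Sum>j<d. b $ j * A $$ (j, l)) = (\<Sum>j<d. \<Sum>k<N. q k j * A $$ (j, l))"
      by (simp add: b_def sum_distrib_right)
    also have "\<dots> = (\<Sum>k<N. r * q (Suc k) l)"
      by (subst sum.swap) (simp add: q_Suc[OF l])
    also have "\<dots> = r * (b $ l + (q N l - q 0 l))"
      using sum_lessThan_telescope[of "\<lambda>k. q k l" N] l
      by (simp add: b_def sum_distrib_left[symmetric] sum_subtractf)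
    also have "\<dots> \<le> r * b $ l"
      using qN[OF l] q0[OF l] order by simp
    finally show ?thesis .
  qed
  then have "admissible_weight d A b r"
    using A b_pos order by (intro admissible_weightI) auto
  then show ?thesis by blast
qed

text \<open>The number \<open>\<theta>\<close> is an eigenvalue of the transpose, hence of \<open>A\<close>, which gives \<open>\<theta> \<le> rho A\<close>.
  Conversely let \<open>v\<close> be a complex eigenvector for an eigenvalue of modulus \<open>rho A\<close>. Taking
  absolute values entrywise gives \<open>rho A |v| \<le> A |v|\<close>, and pairing with \<open>c\<close> gives
  \<open>rho A (c \<bullet> |v|) \<le> \<theta> (c \<bullet> |v|)\<close>, where \<open>c \<bullet> |v|\<close> is positive because \<open>c\<close> is.\<close>

lemma rho_eq_positive_left_eigenvector:
  assumes A: "A \<in> carrier_mat d d" and d: "0 < d"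
    and nonneg: "\<And>i k. i < d \<Longrightarrow> k < d \<Longrightarrow> 0 \<le> A $$ (i, k)"
    and c: "c \<in> R_pos d" and ev: "eigenvector (transpose_mat A) c \<theta>"
  shows "rho A = \<theta>"
proof -
  have cpos: "0 < c $ i" if "i < d" for i using c that by (simp add: R_pos_def)
  have cdim: "c \<in> carrier_vec d" using c by (simp add: R_pos_def)
  have Ac: "(\<Sum>i<d. c $ i * A $$ (i, l)) = \<theta> * c $ l" if l: "l < d" for l
  proof -
    have "(transpose_mat A *\<^sub>v c) $ l = (\<theta> \<cdot>\<^sub>v c) $ l" using ev by (simp add: eigenvector_def)
    then show ?thesis using l A cdim by (simp add: scalar_prod_def atLeast0LessThan mult.commute)
  qed
  have theta: "0 \<le> \<theta>"
  proof -
    have "0 \<le> \<theta> * c $ 0" using Ac[OF d] nonneg cpos d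
      by (metis (no_types, lifting) lessThan_iff less_imp_le mult_nonneg_nonneg sum_nonneg)
    then show ?thesis using cpos[OF d] by (simp add: zero_le_mult_iff)
  qed
  have "eigenvalue A \<theta>"
    using ev A eigenvalue_root_char_poly[of "transpose_mat A" d \<theta>] eigenvalue_root_char_poly[OF A]
    by (auto simp: eigenvalue_def)
  then obtain w where "eigenvector A w \<theta>" by (auto simp: eigenvalue_def)
  from of_real_hom.eigenvector_hom[OF A this, where 'a = complex]
  have "cmod (of_real \<theta>) \<le> rho A"
    using A by (intro cmod_eigenvalue_le_rho[OF A d]) (auto simp: eigenvector_def)
  with theta have lower: "\<theta> \<le> rho A" by simp
  obtain ev v where v: "v \<in> carrier_vec d" "v \<noteq> 0\<^sub>v d"
    and Av: "map_mat complex_of_real A *\<^sub>v v = ev \<cdot>\<^sub>v v" and rho: "rho A = cmod ev"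
    using rho_attained[OF A d] by blast
  have Av_i: "rho A * cmod (v $ i) \<le> (\<Sum>k<d. A $$ (i, k) * cmod (v $ k))" if i: "i < d" for i
  proof -
    have "ev * v $ i = (map_mat complex_of_real A *\<^sub>v v) $ i"
      using Av i v by simp
    also have "\<dots> = (\<Sum>k<d. of_real (A $$ (i, k)) * v $ k)"
      using i A v by (simp add: scalar_prod_def atLeast0LessThan)
    finally have "rho A * cmod (v $ i) = cmod (\<Sum>k<d. of_real (A $$ (i, k)) * v $ k)"
      by (metis rho norm_mult)
    also have "\<dots> \<le> (\<Sum>k<d. A $$ (i, k) * cmod (v $ k))"
      using nonneg i by (intro sum_norm_le) (auto simp: norm_mult)
    finally show ?thesis .
  qed
  let ?S = "\<Sum>i<d. c $ i * cmod (v $ i)"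
  have "rho A * ?S = (\<Sum>i<d. c $ i * (rho A * cmod (v $ i)))"
    by (simp add: sum_distrib_left algebra_simps)
  also have "\<dots> \<le> (\<Sum>i<d. c $ i * (\<Sum>k<d. A $$ (i, k) * cmod (v $ k)))"
    using cpos by (intro sum_mono mult_left_mono Av_i) (auto intro: less_imp_le)
  also have "\<dots> = (\<Sum>i<d. \<Sum>k<d. c $ i * A $$ (i, k) * cmod (v $ k))"
    by (simp add: sum_distrib_left mult.assoc)
  also have "\<dots> = (\<Sum>k<d. (\<Sum>i<d. c $ i * A $$ (i, k)) * cmod (v $ k))"
    by (subst sum.swap) (simp add: sum_distrib_right)
  also have "\<dots> = \<theta> * ?S"
    by (simp add: Ac sum_distrib_left mult.assoc)
  finally have le: "rho A * ?S \<le> \<theta> * ?S" .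
  obtain i where "i < d" "v $ i \<noteq> 0" using v by force
  then have "0 < ?S"
    using cpos by (intro sum_pos2[of _ i]) (auto simp: less_imp_le)
  with le have "rho A \<le> \<theta>" by simp
  with lower show ?thesis by simp
qed

lemma admissible_weight_left_eigenvector:
  assumes A: "A \<in> carrier_mat d d" and d: "0 < d"
    and nonneg: "\<And>i k. i < d \<Longrightarrow> k < d \<Longrightarrow> 0 \<le> A $$ (i, k)" and rho: "rho A < 1"
    and c: "c \<in> R_pos d" and ev: "eigenvector (transpose_mat A) c \<theta>"
  shows "admissible_weight d A c (rho A)"
  using ev c rho rho_eq_positive_left_eigenvector[OF A d nonneg c ev]
  by (auto simp: admissible_weight_def eigenvector_def)

section \<open>Hilbert's projective metric on a product of cones\<close>

definition max_ratio :: "(nat \<Rightarrow> nat) \<Rightarrow> bvec \<Rightarrow> bvec \<Rightarrow> nat \<Rightarrow> real" where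
  "max_ratio n x y i = Max ((\<lambda>j. x i j / y i j) ` {..<n i})"

text \<open>Hilbert's projective metric between the blocks \<open>x\<^sub>i\<close> and \<open>y\<^sub>i\<close>. It is a metric on rays only: it
  does not change when a block is multiplied by a positive number.\<close>

definition hilbert_dist :: "(nat \<Rightarrow> nat) \<Rightarrow> bvec \<Rightarrow> bvec \<Rightarrow> nat \<Rightarrow> real" where
  "hilbert_dist n x y i = ln (max_ratio n x y i * max_ratio n y x i)"

lemma mu_eq_sum_hilbert_dist: "mu d n b x y = (\<Sum>i<d. b $ i * hilbert_dist n x y i)"
  by (simp add: mu_def hilbert_dist_def max_ratio_def)

lemma hilbert_dist_commute: "hilbert_dist n x y i = hilbert_dist n y x i"
  by (simp add: hilbert_dist_def mult.commute)

locale block_cone =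
  fixes d :: nat and n :: "nat \<Rightarrow> nat"
  assumes block_nonempty: "i < d \<Longrightarrow> 1 \<le> n i"
begin

lemma K_pos_D: "x \<in> K_pos d n \<Longrightarrow> i < d \<Longrightarrow> j < n i \<Longrightarrow> 0 < x i j"
  by (simp add: K_pos_def)

lemma K_pos_outside: "x \<in> K_pos d n \<Longrightarrow> \<not> (i < d \<and> j < n i) \<Longrightarrow> x i j = 0"
  by (cases "i < d") (auto simp: K_pos_def block_space_def Rn_def)

lemma K_pos_subset_K_plus: "x \<in> K_pos d n \<Longrightarrow> x \<in> K_plus d n"
  by (auto simp: K_pos_def K_plus_def less_imp_le)

lemma K_posI:
  "(\<And>i j. i < d \<Longrightarrow> j < n i \<Longrightarrow> 0 < x i j) \<Longrightarrow>
   (\<And>i j. \<not> (i < d \<and> j < n i) \<Longrightarrow> x i j = 0) \<Longrightarrow> x \<in> K_pos d n"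
  by (simp add: K_pos_def block_space_def Rn_def not_less)

lemma le_max_ratio_mult:
  assumes "x \<in> K_pos d n" "y \<in> K_pos d n" and i: "i < d" and j: "j < n i"
  shows "x i j \<le> max_ratio n x y i * y i j"
proof -
  have "x i j / y i j \<le> max_ratio n x y i"
    unfolding max_ratio_def using j by (intro Max_ge) auto
  then show ?thesis using K_pos_D[OF assms(2) i j] by (simp add: divide_le_eq)
qed

text \<open>Together with \<open>le_max_ratio_mult\<close> this says that \<open>max_ratio n x y i\<close> is the least \<open>t\<close> with
  \<open>x\<^sub>i \<le> t y\<^sub>i\<close>.\<close>

lemma max_ratio_le:
  assumes "y \<in> K_pos d n" "i < d" and "\<And>j. j < n i \<Longrightarrow> x i j \<le> t * y i j"
  shows "max_ratio n x y i \<le> t"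
  unfolding max_ratio_def using assms block_nonempty[of i]
  by (intro Max.boundedI) (auto simp: divide_le_eq K_pos_D lessThan_empty_iff)

lemma max_ratio_pos:
  assumes "x \<in> K_pos d n" "y \<in> K_pos d n" and i: "i < d"
  shows "0 < max_ratio n x y i"
proof -
  have "0 < n i" using block_nonempty[OF i] by simp
  then have "0 < x i 0" "0 < y i 0" "x i 0 \<le> max_ratio n x y i * y i 0"
    using assms K_pos_D le_max_ratio_mult by auto
  then show ?thesis by (smt (verit) mult_nonpos_nonneg)
qed

text \<open>Going from \<open>x\<^sub>i\<close> to \<open>y\<^sub>i\<close> and back gives \<open>x\<^sub>i \<le> M M' x\<^sub>i\<close> for the two maximal ratios \<open>M\<close>
  and \<open>M'\<close>, so \<open>1 \<le> M M'\<close>.\<close>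

lemma hilbert_dist_nonneg:
  assumes "x \<in> K_pos d n" "y \<in> K_pos d n" and i: "i < d"
  shows "0 \<le> hilbert_dist n x y i"
proof -
  have j: "0 < n i" using block_nonempty[OF i] by simp
  have "1 * x i 0 \<le> (max_ratio n x y i * max_ratio n y x i) * x i 0"
    using le_max_ratio_mult[OF assms(1,2) i j]
      mult_left_mono[OF le_max_ratio_mult[OF assms(2,1) i j]
        less_imp_le[OF max_ratio_pos[OF assms]]]
    by (simp add: mult.assoc)
  then have "1 \<le> max_ratio n x y i * max_ratio n y x i"
    using K_pos_D[OF assms(1) i j] by (simp only: mult_le_cancel_right_pos)
  then show ?thesis by (simp add: hilbert_dist_def)
qed

lemma hilbert_dist_eq:
  assumes "x \<in> K_pos d n" "y \<in> K_pos d n" and "i < d"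
  shows "hilbert_dist n x y i = ln (max_ratio n x y i) + ln (max_ratio n y x i)"
  using assms max_ratio_pos by (simp add: hilbert_dist_def ln_mult_pos)

lemma ln_max_ratio_triangle:
  assumes "x \<in> K_pos d n" "y \<in> K_pos d n" "z \<in> K_pos d n" and i: "i < d"
  shows "ln (max_ratio n x z i) \<le> ln (max_ratio n x y i) + ln (max_ratio n y z i)"
proof -
  have "max_ratio n x z i \<le> max_ratio n x y i * max_ratio n y z i"
  proof (rule max_ratio_le[OF assms(3) i])
    fix j assume j: "j < n i"
    have "x i j \<le> max_ratio n x y i * y i j" by (rule le_max_ratio_mult[OF assms(1,2) i j])
    also have "\<dots> \<le> max_ratio n x y i * (max_ratio n y z i * z i j)"
      using max_ratio_pos[OF assms(1,2) i]
      by (intro mult_left_mono le_max_ratio_mult[OF assms(2,3) i j]) simp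
    finally show "x i j \<le> max_ratio n x y i * max_ratio n y z i * z i j" by simp
  qed
  then show ?thesis
    using assms max_ratio_pos by (simp flip: ln_mult_pos)
qed

lemma hilbert_dist_triangle:
  assumes "x \<in> K_pos d n" "y \<in> K_pos d n" "z \<in> K_pos d n" and i: "i < d"
  shows "hilbert_dist n x z i \<le> hilbert_dist n x y i + hilbert_dist n y z i"
  using ln_max_ratio_triangle[OF assms] ln_max_ratio_triangle[OF assms(3,2,1) i]
  by (simp add: hilbert_dist_eq assms)

lemma hilbert_dist_le:
  assumes "x \<in> K_pos d n" "y \<in> K_pos d n" and i: "i < d"
    and "\<And>j. j < n i \<Longrightarrow> x i j \<le> s * y i j" and "\<And>j. j < n i \<Longrightarrow> y i j \<le> t * x i j"
  shows "hilbert_dist n x y i \<le> ln (s * t)"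
proof -
  have "max_ratio n x y i \<le> s" "max_ratio n y x i \<le> t"
    using assms by (auto intro: max_ratio_le)
  with max_ratio_pos[OF assms(1,2) i] max_ratio_pos[OF assms(2,1) i] show ?thesis
    unfolding hilbert_dist_def by (intro ln_mono) (auto intro: mult_mono)
qed

lemma mu_nonneg:
  assumes "b \<in> R_pos d" "x \<in> K_pos d n" "y \<in> K_pos d n"
  shows "0 \<le> mu d n b x y"
  using assms hilbert_dist_nonneg unfolding mu_eq_sum_hilbert_dist R_pos_def
  by (auto intro!: sum_nonneg mult_nonneg_nonneg simp: less_imp_le)

lemma mu_triangle:
  assumes "b \<in> R_pos d" "x \<in> K_pos d n" "y \<in> K_pos d n" "z \<in> K_pos d n"
  shows "mu d n b x z \<le> mu d n b x y + mu d n b y z"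
proof -
  have "b $ i * hilbert_dist n x z i \<le> b $ i * hilbert_dist n x y i + b $ i * hilbert_dist n y z i"
    if "i < d" for i
    using hilbert_dist_triangle[OF assms(2-4) that] assms(1) that
    by (simp add: R_pos_def flip: distrib_left)
  then show ?thesis
    unfolding mu_eq_sum_hilbert_dist sum.distrib[symmetric] by (intro sum_mono) simp
qed

lemma hilbert_dist_le_mu:
  assumes b: "b \<in> R_pos d" and xy: "x \<in> K_pos d n" "y \<in> K_pos d n" and i: "i < d"
  shows "hilbert_dist n x y i \<le> mu d n b x y / b $ i"
proof -
  have "b $ i * hilbert_dist n x y i \<le> mu d n b x y"
    unfolding mu_eq_sum_hilbert_dist
    using b i hilbert_dist_nonneg[OF xy]
    by (intro member_le_sum) (auto simp: R_pos_def less_imp_le)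
  then show ?thesis using b i by (simp add: R_pos_def le_divide_eq mult.commute)
qed

text \<open>A block has finitely many entries, and the entries of the limit are positive, so entrywise
  convergence is uniform in the multiplicative sense.\<close>

lemma eventually_le_scale:
  assumes v: "\<And>k. v k \<in> K_pos d n" and u: "u \<in> K_pos d n" and i: "i < d" and t: "1 < t"
    and lim: "\<And>j. j < n i \<Longrightarrow> (\<lambda>k. v k i j) \<longlonglongrightarrow> u i j"
  shows "\<forall>\<^sub>F k in sequentially. \<forall>j<n i. u i j \<le> t * v k i j \<and> v k i j \<le> t * u i j"
proof -
  have "\<forall>\<^sub>F k in sequentially. \<forall>j\<in>{..<n i}. u i j \<le> t * v k i j \<and> v k i j \<le> t * u i j"
  proof (intro eventually_ball_finite ballI)
    fix j assume "j \<in> {..<n i}"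
    then have j: "j < n i" by simp
    have pos: "0 < u i j" by (rule K_pos_D[OF u i j])
    have "u i j / t < u i j" "u i j < t * u i j" using pos t by (auto simp: divide_less_eq)
    then have "\<forall>\<^sub>F k in sequentially. u i j / t < v k i j"
      "\<forall>\<^sub>F k in sequentially. v k i j < t * u i j"
      by (auto intro: order_tendstoD[OF lim[OF j]])
    then show "\<forall>\<^sub>F k in sequentially. u i j \<le> t * v k i j \<and> v k i j \<le> t * u i j"
    proof eventually_elim
      case (elim k)
      then show ?case using t by (simp add: divide_less_eq mult.commute less_imp_le)
    qed
  qed simp
  then show ?thesis by (simp add: Ball_def)
qed

lemma hilbert_dist_tendsto_0:
  assumes v: "\<And>k. v k \<in> K_pos d n" and u: "u \<in> K_pos d n" and i: "i < d"
    and lim: "\<And>j. j < n i \<Longrightarrow> (\<lambda>k. v k i j) \<longlonglongrightarrow> u i j"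
  shows "(\<lambda>k. hilbert_dist n u (v k) i) \<longlonglongrightarrow> 0"
proof (rule order_tendstoI)
  fix a :: real assume "a < 0"
  then have "a < hilbert_dist n u (v k) i" for k
    using hilbert_dist_nonneg[OF u v i, of k] by linarith
  then show "\<forall>\<^sub>F k in sequentially. a < hilbert_dist n u (v k) i" by simp
next
  fix a :: real assume a: "0 < a"
  \<comment> \<open>Both ratios end up at most \<open>t\<close>, so the distance is at most \<open>2 a / 3 < a\<close>.\<close>
  define t where "t = exp (a / 3)"
  have "1 < t" using a by (simp add: t_def)
  have "\<forall>\<^sub>F k in sequentially. \<forall>j<n i. u i j \<le> t * v k i j \<and> v k i j \<le> t * u i j"
    by (rule eventually_le_scale[OF v u i \<open>1 < t\<close> lim])
  then show "\<forall>\<^sub>F k in sequentially. hilbert_dist n u (v k) i < a"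
  proof eventually_elim
    case (elim k)
    then have "hilbert_dist n u (v k) i \<le> ln (t * t)"
      by (intro hilbert_dist_le[OF u v i]) auto
    also have "\<dots> < a" using a by (simp add: t_def flip: exp_add)
    finally show ?case .
  qed
qed

end

section \<open>Hilbert's metric on blocks of norm one\<close>

locale normed_block_cone = block_cone +
  fixes \<gamma> :: "nat \<Rightarrow> (nat \<Rightarrow> real) \<Rightarrow> real"
  assumes monotonic: "i < d \<Longrightarrow> monotonic_norm (n i) (\<gamma> i)"
begin

lemma K_pos_block_in_Rn: "x \<in> K_pos d n \<Longrightarrow> i < d \<Longrightarrow> x i \<in> Rn (n i)"
  by (simp add: K_pos_def block_space_def)

lemma norm_scale:
  assumes "v \<in> Rn (n i)" "i < d" "0 \<le> t"
  shows "\<gamma> i (\<lambda>j. t * v j) = t * \<gamma> i v"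
  using monotonic[OF assms(2)] assms unfolding monotonic_norm_def norm_on_Rn_def by auto

lemma norm_pos:
  assumes "y \<in> K_pos d n" "i < d"
  shows "0 < \<gamma> i (y i)"
proof -
  have "0 \<le> \<gamma> i (y i)" "\<gamma> i (y i) = 0 \<longleftrightarrow> (\<forall>j<n i. y i j = 0)"
    using monotonic[OF assms(2)] K_pos_block_in_Rn[OF assms]
    unfolding monotonic_norm_def norm_on_Rn_def by auto
  moreover have "0 < y i 0" "0 < n i"
    using block_nonempty[OF assms(2)] K_pos_D[OF assms, of 0] by auto
  ultimately show ?thesis by (metis less_irrefl order_le_less)
qed

lemma norm_le_scale:
  assumes x: "x \<in> K_pos d n" and y: "y \<in> K_pos d n" and i: "i < d" and t: "0 \<le> t"
    and le: "\<And>j. j < n i \<Longrightarrow> x i j \<le> t * y i j"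
  shows "\<gamma> i (x i) \<le> t * \<gamma> i (y i)"
proof -
  have "\<gamma> i (x i) \<le> \<gamma> i (\<lambda>j. t * y i j)"
  proof (rule mono_onD[of "{v \<in> Rn (n i). \<forall>j<n i. 0 \<le> v j}" "\<gamma> i"])
    show "mono_on {v \<in> Rn (n i). \<forall>j<n i. 0 \<le> v j} (\<gamma> i)"
      using monotonic[OF i] by (simp add: monotonic_norm_def)
    show "x i \<le> (\<lambda>j. t * y i j)"
    proof (rule le_funI)
      fix j show "x i j \<le> t * y i j"
        using le K_pos_outside[OF x, of i j] K_pos_outside[OF y, of i j] by (cases "j < n i") auto
    qed
  qed (use K_pos_block_in_Rn[OF x i] K_pos_block_in_Rn[OF y i] K_pos_D[OF x i] K_pos_D[OF y i] t
        in \<open>auto simp: Rn_def less_imp_le\<close>)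
  also have "\<dots> = t * \<gamma> i (y i)"
    by (rule norm_scale[OF K_pos_block_in_Rn[OF y i] i t])
  finally show ?thesis .
qed

lemma S_pos_K_pos: "x \<in> S_pos d n \<gamma> \<Longrightarrow> x \<in> K_pos d n"
  by (simp add: S_pos_def)

text \<open>By monotonicity of the norms, \<open>x\<^sub>i \<le> M y\<^sub>i\<close> forces
  \<open>1 = \<gamma>\<^sub>i x\<^sub>i \<le> M \<gamma>\<^sub>i y\<^sub>i = M\<close>. Hence each of the two maximal ratios is at most their product,
  and on the normalized set the projective metric controls the entries themselves.\<close>

lemma one_le_max_ratio:
  assumes x: "x \<in> S_pos d n \<gamma>" and y: "y \<in> S_pos d n \<gamma>" and i: "i < d"
  shows "1 \<le> max_ratio n x y i"
proof -
  note K = S_pos_K_pos[OF x] S_pos_K_pos[OF y]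
  have "\<gamma> i (x i) \<le> max_ratio n x y i * \<gamma> i (y i)"
    using max_ratio_pos[OF K i] by (intro norm_le_scale[OF K i] le_max_ratio_mult[OF K i]) auto
  with x y i show ?thesis by (simp add: S_pos_def)
qed

lemma S_pos_le_exp_hilbert_dist:
  assumes x: "x \<in> S_pos d n \<gamma>" and y: "y \<in> S_pos d n \<gamma>" and i: "i < d" and j: "j < n i"
  shows "x i j \<le> exp (hilbert_dist n x y i) * y i j"
proof -
  note K = S_pos_K_pos[OF x] S_pos_K_pos[OF y]
  have "x i j \<le> max_ratio n x y i * 1 * y i j" using le_max_ratio_mult[OF K i j] by simp
  also have "\<dots> \<le> max_ratio n x y i * max_ratio n y x i * y i j"
    using one_le_max_ratio[OF y x i] max_ratio_pos[OF K i] K_pos_D[OF K(2) i j]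
    by (intro mult_right_mono mult_left_mono) auto
  also have "\<dots> = exp (hilbert_dist n x y i) * y i j"
    using max_ratio_pos[OF K i] max_ratio_pos[OF K(2,1) i] by (simp add: hilbert_dist_def)
  finally show ?thesis .
qed

lemma ln_diff_le_hilbert_dist:
  assumes x: "x \<in> S_pos d n \<gamma>" and y: "y \<in> S_pos d n \<gamma>" and i: "i < d" and j: "j < n i"
  shows "\<bar>ln (x i j) - ln (y i j)\<bar> \<le> hilbert_dist n x y i"
proof -
  have half: "ln (x i j) - ln (y i j) \<le> hilbert_dist n x y i"
    if x: "x \<in> S_pos d n \<gamma>" and y: "y \<in> S_pos d n \<gamma>" for x y
  proof -
    note pos = K_pos_D[OF S_pos_K_pos[OF x] i j] K_pos_D[OF S_pos_K_pos[OF y] i j]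
    have "ln (x i j) \<le> ln (exp (hilbert_dist n x y i) * y i j)"
      using S_pos_le_exp_hilbert_dist[OF x y i j] pos by (intro ln_mono) auto
    also have "\<dots> = hilbert_dist n x y i + ln (y i j)" using pos by (simp add: ln_mult_pos)
    finally show ?thesis by simp
  qed
  show ?thesis
    using half[OF x y] half[OF y x] hilbert_dist_commute[of n x y i] by simp
qed

lemma S_pos_tendsto:
  assumes v: "\<And>k. v k \<in> S_pos d n \<gamma>" and u: "u \<in> S_pos d n \<gamma>" and b: "b \<in> R_pos d"
    and mu: "(\<lambda>k. mu d n b u (v k)) \<longlonglongrightarrow> 0"
  shows "v \<longlonglongrightarrow> u"
  unfolding tendsto_fun_iff
proof (intro allI)
  fix i j
  note K = S_pos_K_pos[OF u] S_pos_K_pos[OF v]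
  show "(\<lambda>k. v k i j) \<longlonglongrightarrow> u i j"
  proof (cases "i < d \<and> j < n i")
    case False
    then show ?thesis using K_pos_outside[OF K(1)] K_pos_outside[OF K(2)] by simp
  next
    case True
    then have i: "i < d" and j: "j < n i" by auto
    note pos = K_pos_D[OF K(1) i j] K_pos_D[OF K(2) i j]
    have "(\<lambda>k. mu d n b u (v k) / b $ i) \<longlonglongrightarrow> 0 / b $ i"
      using b i by (intro tendsto_divide mu) (auto simp: R_pos_def)
    then have "(\<lambda>k. mu d n b u (v k) / b $ i) \<longlonglongrightarrow> 0" by simp
    then have "(\<lambda>k. ln (v k i j) - ln (u i j)) \<longlonglongrightarrow> 0"
    proof (rule tendsto_0_le[where K = 1, OF _ always_eventually], intro allI)
      fix k
      have "\<bar>ln (v k i j) - ln (u i j)\<bar> \<le> hilbert_dist n u (v k) i"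
        using ln_diff_le_hilbert_dist[OF v u i j] by (simp add: hilbert_dist_commute)
      also have "\<dots> \<le> mu d n b u (v k) / b $ i" by (rule hilbert_dist_le_mu[OF b K i])
      finally show "norm (ln (v k i j) - ln (u i j)) \<le> norm (mu d n b u (v k) / b $ i) * 1"
        unfolding real_norm_def by linarith
    qed
    then have "(\<lambda>k. exp (ln (v k i j))) \<longlonglongrightarrow> exp (ln (u i j))"
      by (intro tendsto_exp) (simp add: LIM_zero_iff)
    then show ?thesis using pos by simp
  qed
qed

text \<open>For every \<open>t > 1\<close> some \<open>v\<^sub>k\<close> satisfies \<open>u\<^sub>i \<le> t v\<^sub>k\<^sub>i\<close> and
  \<open>v\<^sub>k\<^sub>i \<le> t u\<^sub>i\<close>, so monotonicity puts \<open>\<gamma>\<^sub>i u\<^sub>i\<close> between \<open>1 / t\<close> and \<open>t\<close>.\<close>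

lemma S_pos_closed_in_K_pos:
  assumes v: "\<And>k. v k \<in> S_pos d n \<gamma>" and u: "u \<in> K_pos d n"
    and lim: "\<And>i j. i < d \<Longrightarrow> j < n i \<Longrightarrow> (\<lambda>k. v k i j) \<longlonglongrightarrow> u i j"
  shows "u \<in> S_pos d n \<gamma>"
proof -
  have "\<gamma> i (u i) = 1" if i: "i < d" for i
  proof -
    note Kv = S_pos_K_pos[OF v]
    have pos: "0 < \<gamma> i (u i)" by (rule norm_pos[OF u i])
    have close: "\<gamma> i (u i) \<le> t \<and> 1 \<le> t * \<gamma> i (u i)" if t: "1 < t" for t
    proof -
      obtain k where k: "\<forall>j<n i. u i j \<le> t * v k i j \<and> v k i j \<le> t * u i j"
        using eventually_happens'[OF sequentially_bot eventually_le_scale[OF Kv u i t lim[OF i]]]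
        by blast
      have "\<gamma> i (v k i) = 1" using v i by (simp add: S_pos_def)
      moreover have "\<gamma> i (u i) \<le> t * \<gamma> i (v k i)" "\<gamma> i (v k i) \<le> t * \<gamma> i (u i)"
        using k t by (auto intro!: norm_le_scale u Kv i)
      ultimately show ?thesis by simp
    qed
    have "\<gamma> i (u i) \<le> 1" by (rule dense_ge) (use close in blast)
    moreover have "1 / \<gamma> i (u i) \<le> 1"
      by (rule dense_ge) (use close pos in \<open>simp add: divide_le_eq\<close>)
    ultimately show ?thesis using pos by (simp add: divide_le_eq)
  qed
  with u show ?thesis by (simp add: S_pos_def)
qed

end

section \<open>Order-preserving multi-homogeneous maps contract Hilbert's metric\<close>

locale multi_homogeneous_map = normed_block_cone +
  fixes F :: "bvec \<Rightarrow> bvec" and A :: "real mat"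
  assumes Hd: "F \<in> Hd d n" and homogeneous: "homogeneity_matrix d n F A"
begin

lemma A_carrier: "A \<in> carrier_mat d d"
  using homogeneous by (simp add: homogeneity_matrix_def)

lemma F_scale:
  "x \<in> K_plus d n \<Longrightarrow> a \<in> R_pos d \<Longrightarrow> F (block_scale a x) = block_scale (vec_powr a A) (F x)"
  using homogeneous by (simp add: homogeneity_matrix_def)

lemma F_mono: "x \<in> K_plus d n \<Longrightarrow> y \<in> K_plus d n \<Longrightarrow> x \<le> y \<Longrightarrow> F x \<le> F y"
  using Hd by (auto simp: Hd_def dest: mono_onD)

lemma F_K_plus: "x \<in> K_plus d n \<Longrightarrow> F x \<in> K_plus d n"
  using Hd by (auto simp: Hd_def)

lemma F_one: "F (block_one d n) \<in> K_pos d n"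
  using Hd by (simp add: Hd_def)

lemma one_K_pos: "block_one d n \<in> K_pos d n"
  by (rule K_posI) (auto simp: block_one_def)

lemma block_scale_nth: "a \<in> R_pos d \<Longrightarrow> i < d \<Longrightarrow> block_scale a x i j = a $ i * x i j"
  by (auto simp: block_scale_def R_pos_def)

lemma block_scale_K_pos: "a \<in> R_pos d \<Longrightarrow> x \<in> K_pos d n \<Longrightarrow> block_scale a x \<in> K_pos d n"
  by (rule K_posI) (auto simp: block_scale_def R_pos_def K_pos_D K_pos_outside)

lemma vec_powr_nth: "i < d \<Longrightarrow> vec_powr a A $ i = (\<Prod>k<d. (a $ k) powr (A $$ (i, k)))"
  using A_carrier by (simp add: vec_powr_def)

lemma vec_powr_pos: "a \<in> R_pos d \<Longrightarrow> i < d \<Longrightarrow> 0 < vec_powr a A $ i"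
  unfolding vec_powr_nth by (rule prod_pos) (auto simp: R_pos_def less_imp_neq)

lemma F_le_scale:
  assumes x: "x \<in> K_pos d n" and y: "y \<in> K_pos d n" and a: "a \<in> R_pos d"
    and le: "\<And>i j. i < d \<Longrightarrow> j < n i \<Longrightarrow> x i j \<le> a $ i * y i j"
    and i: "i < d"
  shows "F x i j \<le> vec_powr a A $ i * F y i j"
proof -
  have "x i j \<le> block_scale a y i j" for i j
    using le block_scale_nth[OF a] K_pos_outside[OF x, of i j]
      K_pos_outside[OF block_scale_K_pos[OF a y], of i j]
    by (cases "i < d \<and> j < n i") auto
  then have "F x \<le> F (block_scale a y)"
    using x y a by (intro F_mono K_pos_subset_K_plus block_scale_K_pos) (auto simp: le_fun_def)
  then have "F x i j \<le> block_scale (vec_powr a A) (F y) i j"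
    using y a by (simp add: F_scale K_pos_subset_K_plus le_fun_def)
  then show ?thesis using i A_carrier by (simp add: block_scale_def vec_powr_def)
qed

text \<open>Doubling block \<open>k\<close> of the all-ones vector does not decrease \<open>F\<close>, and it multiplies block \<open>i\<close> of
  the positive vector \<open>F 1\<close> by \<open>2 powr A\<^sub>i\<^sub>k\<close>, so this factor is at least \<open>1\<close>.\<close>

lemma A_nonneg:
  assumes i: "i < d" and k: "k < d"
  shows "0 \<le> A $$ (i, k)"
proof -
  let ?e = "block_one d n"
  let ?a = "vec d (\<lambda>l. if l = k then 2 else 1)"
  have a: "?a \<in> R_pos d" by (simp add: R_pos_def)
  have "0 < n i" using block_nonempty[OF i] by simp
  then have pos: "0 < F ?e i 0" by (rule K_pos_D[OF F_one i])
  have "F ?e i 0 \<le> vec_powr ?a A $ i * F ?e i 0"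
    by (rule F_le_scale[OF one_K_pos one_K_pos a _ i]) (auto simp: block_one_def)
  with pos have "1 \<le> vec_powr ?a A $ i" by simp
  also have "vec_powr ?a A $ i = (\<Prod>l<d. if l = k then 2 powr (A $$ (i, k)) else 1)"
    unfolding vec_powr_nth[OF i] by (intro prod.cong) auto
  also have "\<dots> = 2 powr (A $$ (i, k))" using k by simp
  finally show ?thesis using powr_le_cancel_iff[of 2 0 "A $$ (i, k)"] by simp
qed

definition ratio_vec :: "bvec \<Rightarrow> bvec \<Rightarrow> real vec" where
  "ratio_vec x y = vec d (max_ratio n x y)"

lemma ratio_vec_R_pos: "x \<in> K_pos d n \<Longrightarrow> y \<in> K_pos d n \<Longrightarrow> ratio_vec x y \<in> R_pos d"
  by (simp add: ratio_vec_def R_pos_def max_ratio_pos)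

lemma F_le_ratio_vec:
  assumes x: "x \<in> K_pos d n" and y: "y \<in> K_pos d n" and i: "i < d"
  shows "F x i j \<le> vec_powr (ratio_vec x y) A $ i * F y i j"
  by (rule F_le_scale[OF x y ratio_vec_R_pos[OF x y] _ i])
    (simp add: ratio_vec_def le_max_ratio_mult[OF x y])

text \<open>A positive rescaling of the blocks makes \<open>x\<close> dominate the all-ones vector, so one of \<open>F x\<close>
  dominates the positive vector \<open>F 1\<close>.\<close>

lemma F_K_pos:
  assumes x: "x \<in> K_pos d n"
  shows "F x \<in> K_pos d n"
proof -
  have "0 < F x i j" if i: "i < d" and j: "j < n i" for i j
  proof -
    have "0 < F (block_one d n) i j" by (rule K_pos_D[OF F_one i j])
    also have "\<dots> \<le> vec_powr (ratio_vec (block_one d n) x) A $ i * F x i j"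
      by (rule F_le_ratio_vec[OF one_K_pos x i])
    finally show ?thesis
      using vec_powr_pos[OF ratio_vec_R_pos[OF one_K_pos x] i] by (simp add: zero_less_mult_iff)
  qed
  then show ?thesis
    using F_K_plus[OF K_pos_subset_K_plus[OF x]] by (simp add: K_pos_def K_plus_def)
qed

lemma ln_vec_powr:
  assumes "a \<in> R_pos d" "i < d"
  shows "ln (vec_powr a A $ i) = (\<Sum>k<d. A $$ (i, k) * ln (a $ k))"
  unfolding vec_powr_nth[OF assms(2)] using assms
  by (subst ln_prod) (auto simp: R_pos_def less_imp_neq)

text \<open>From \<open>x \<le> M \<otimes> y\<close> follows \<open>F x \<le> M\<^sup>A \<otimes> F y\<close>, and the logarithm turns the power \<open>M\<^sup>A\<close> into the
  linear map \<open>A\<close>: the vector of the block distances between images is bounded by \<open>A\<close> applied to the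
  vector of the block distances.\<close>

lemma hilbert_dist_F_le:
  assumes x: "x \<in> K_pos d n" and y: "y \<in> K_pos d n" and i: "i < d"
  shows "hilbert_dist n (F x) (F y) i \<le> (\<Sum>k<d. A $$ (i, k) * hilbert_dist n x y k)"
proof -
  note R = ratio_vec_R_pos[OF x y] ratio_vec_R_pos[OF y x]
  have "hilbert_dist n (F x) (F y) i
      \<le> ln (vec_powr (ratio_vec x y) A $ i * vec_powr (ratio_vec y x) A $ i)"
    using x y i by (intro hilbert_dist_le F_K_pos F_le_ratio_vec)
  also have "\<dots> = (\<Sum>k<d. A $$ (i, k) * ln (max_ratio n x y k))
      + (\<Sum>k<d. A $$ (i, k) * ln (max_ratio n y x k))"
    using R i by (simp add: ln_mult_pos vec_powr_pos ln_vec_powr) (simp add: ratio_vec_def)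
  also have "\<dots> = (\<Sum>k<d. A $$ (i, k) * hilbert_dist n x y k)"
    unfolding sum.distrib[symmetric]
    by (intro sum.cong) (auto simp: hilbert_dist_eq[OF x y] algebra_simps)
  finally show ?thesis .
qed

definition normalized_map :: "bvec \<Rightarrow> bvec" where
  "normalized_map x = block_normalize \<gamma> (F x)"

lemma normalized_map_S_pos:
  assumes "x \<in> K_pos d n"
  shows "normalized_map x \<in> S_pos d n \<gamma>"
proof -
  note K = F_K_pos[OF assms]
  have "\<gamma> i (normalized_map x i) = 1" if i: "i < d" for i
  proof -
    have "\<gamma> i (normalized_map x i) = \<gamma> i (\<lambda>j. (1 / \<gamma> i (F x i)) * F x i j)"
      by (simp add: normalized_map_def block_normalize_def)
    also have "\<dots> = 1 / \<gamma> i (F x i) * \<gamma> i (F x i)"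
      using norm_pos[OF K i] by (intro norm_scale K_pos_block_in_Rn K i) simp
    finally show ?thesis using norm_pos[OF K i] by simp
  qed
  moreover have "normalized_map x \<in> K_pos d n"
    by (rule K_posI) (auto simp: normalized_map_def block_normalize_def
      K_pos_D[OF K] K_pos_outside[OF K] norm_pos[OF K])
  ultimately show ?thesis by (simp add: S_pos_def)
qed

lemma hilbert_dist_normalized_map_le:
  assumes x: "x \<in> K_pos d n" and y: "y \<in> K_pos d n" and i: "i < d"
  shows "hilbert_dist n (normalized_map x) (normalized_map y) i \<le> hilbert_dist n (F x) (F y) i"
proof -
  note Fx = F_K_pos[OF x] and Fy = F_K_pos[OF y]
  note pos = norm_pos[OF Fx i] norm_pos[OF Fy i]
  have "hilbert_dist n (normalized_map x) (normalized_map y) i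
    \<le> ln ((max_ratio n (F x) (F y) i * (\<gamma> i (F y i) / \<gamma> i (F x i)))
        * (max_ratio n (F y) (F x) i * (\<gamma> i (F x i) / \<gamma> i (F y i))))"
    using x y i pos le_max_ratio_mult[OF Fx Fy i] le_max_ratio_mult[OF Fy Fx i]
    by (intro hilbert_dist_le S_pos_K_pos[OF normalized_map_S_pos])
      (auto simp: normalized_map_def block_normalize_def divide_right_mono)
  also have "\<dots> = hilbert_dist n (F x) (F y) i"
    using pos by (simp add: hilbert_dist_def)
  finally show ?thesis .
qed

text \<open>Weighting the block distances with \<open>b\<close> moves \<open>A\<close> to the other side as its transpose, where the
  inequality that defines an admissible weight applies.\<close>

lemma mu_normalized_map_le:
  assumes b: "admissible_weight d A b r" and x: "x \<in> K_pos d n" and y: "y \<in> K_pos d n"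
  shows "mu d n b (normalized_map x) (normalized_map y) \<le> r * mu d n b x y"
proof -
  have bpos: "0 \<le> b $ i" if "i < d" for i
    using b that by (simp add: admissible_weight_def R_pos_def less_imp_le)
  have "mu d n b (normalized_map x) (normalized_map y)
      \<le> (\<Sum>i<d. b $ i * (\<Sum>k<d. A $$ (i, k) * hilbert_dist n x y k))"
    unfolding mu_eq_sum_hilbert_dist
    using order_trans[OF hilbert_dist_normalized_map_le[OF x y] hilbert_dist_F_le[OF x y]]
    by (intro sum_mono mult_left_mono bpos) auto
  also have "\<dots> = (\<Sum>k<d. (\<Sum>i<d. b $ i * A $$ (i, k)) * hilbert_dist n x y k)"
    by (simp add: sum_distrib_left sum_distrib_right mult.assoc) (rule sum.swap)
  also have "\<dots> \<le> (\<Sum>k<d. (r * b $ k) * hilbert_dist n x y k)"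
    using admissible_weightD[OF A_carrier b] hilbert_dist_nonneg[OF x y]
    by (intro sum_mono mult_right_mono) auto
  also have "\<dots> = r * mu d n b x y"
    by (simp add: mu_eq_sum_hilbert_dist sum_distrib_left mult.assoc)
  finally show ?thesis .
qed

text \<open>On the normalized set the eigenvalue of a block is determined as \<open>\<lambda>\<^sub>i = \<gamma>\<^sub>i (F\<^sub>i u)\<close>, so the
  eigenvalue equation becomes a fixed point equation.\<close>

lemma normalized_eigenvector_iff:
  "normalized_eigenvector d n \<gamma> F u \<longleftrightarrow> u \<in> S_pos d n \<gamma> \<and> normalized_map u = u"
proof
  assume "normalized_eigenvector d n \<gamma> F u"
  then obtain l where u: "u \<in> S_pos d n \<gamma>" and l: "l \<in> R_pos d" and Fu: "F u = block_scale l u"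
    by (auto simp: normalized_eigenvector_def)
  note K = S_pos_K_pos[OF u]
  have "normalized_map u i j = u i j" for i j
  proof (cases "i < d")
    case True
    have eq: "F u i = (\<lambda>j. l $ i * u i j)" using Fu True l by (auto simp: block_scale_nth)
    have "\<gamma> i (F u i) = l $ i"
      using u l True norm_scale[OF K_pos_block_in_Rn[OF K True] True, of "l $ i"]
      by (simp add: eq S_pos_def R_pos_def less_imp_le)
    then show ?thesis using l True
      by (simp add: normalized_map_def block_normalize_def) (simp add: eq R_pos_def less_imp_neq[symmetric])
  next
    case False
    then show ?thesis using K_pos_outside[OF K] K_pos_outside[OF F_K_pos[OF K]]
      by (simp add: normalized_map_def block_normalize_def)
  qed
  with u show "u \<in> S_pos d n \<gamma> \<and> normalized_map u = u" by (auto simp: fun_eq_iff)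
next
  assume u: "u \<in> S_pos d n \<gamma> \<and> normalized_map u = u"
  then have K: "u \<in> K_pos d n" using S_pos_K_pos by blast
  let ?l = "vec d (\<lambda>i. \<gamma> i (F u i))"
  have l: "?l \<in> R_pos d" using norm_pos[OF F_K_pos[OF K]] by (simp add: R_pos_def)
  have "F u i j = block_scale ?l u i j" for i j
  proof (cases "i < d")
    case True
    have "u i j = F u i j / \<gamma> i (F u i)" using u by (metis normalized_map_def block_normalize_def)
    then show ?thesis using norm_pos[OF F_K_pos[OF K] True] True by (simp add: block_scale_def)
  next
    case False
    then show ?thesis using K_pos_outside[OF F_K_pos[OF K]] by (simp add: block_scale_def)
  qed
  then show "normalized_eigenvector d n \<gamma> F u"
    using u l by (auto simp: normalized_eigenvector_def fun_eq_iff)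
qed

section \<open>Convergence of the normalized iteration\<close>

context
  fixes b :: "real vec" and r :: real and x :: "nat \<Rightarrow> bvec"
  assumes weight: "admissible_weight d A b r" and r_nonneg: "0 \<le> r"
    and start: "x 0 \<in> S_pos d n \<gamma>" and step: "\<And>k. x (Suc k) = normalized_map (x k)"
begin

lemma b_R_pos: "b \<in> R_pos d" and r_less_1: "r < 1"
  using weight by (simp_all add: admissible_weight_def)

lemma iterate_S_pos: "x k \<in> S_pos d n \<gamma>"
  by (induction k) (simp_all add: start step normalized_map_S_pos S_pos_K_pos)

text \<open>The second orbit \<open>y\<close> is later either constant at a fixed point or the shifted orbit \<open>x\<^sub>k\<^sub>+\<^sub>1\<close>.\<close>

lemma mu_iterate_le:
  assumes y: "\<And>k. y k \<in> K_pos d n" and ystep: "\<And>k. y (Suc k) = normalized_map (y k)"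
  shows "mu d n b (y k) (x k) \<le> r ^ k * mu d n b (y 0) (x 0)"
proof (induction k)
  case (Suc k)
  have "mu d n b (y (Suc k)) (x (Suc k)) \<le> r * mu d n b (y k) (x k)"
    unfolding step ystep by (rule mu_normalized_map_le[OF weight y S_pos_K_pos[OF iterate_S_pos]])
  also have "\<dots> \<le> r * (r ^ k * mu d n b (y 0) (x 0))"
    using Suc r_nonneg by (rule mult_left_mono)
  finally show ?case by simp
qed simp

text \<open>A fixed point \<open>u\<close> satisfies \<open>mu(u, x\<^sub>0) \<le> mu(u, x\<^sub>1) + mu(x\<^sub>1, x\<^sub>0) \<le> r mu(u, x\<^sub>0) + mu(x\<^sub>1, x\<^sub>0)\<close>,
  which is solved for \<open>mu(u, x\<^sub>0)\<close>.\<close>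

lemma mu_fixed_point_le:
  assumes u: "u \<in> S_pos d n \<gamma>" and Tu: "normalized_map u = u"
  shows "mu d n b u (x k) \<le> r ^ k / (1 - r) * mu d n b (x 1) (x 0)"
proof -
  note K = S_pos_K_pos[OF u] S_pos_K_pos[OF iterate_S_pos]
  have "mu d n b u (x 0) \<le> mu d n b u (x 1) + mu d n b (x 1) (x 0)"
    by (rule mu_triangle[OF b_R_pos K K(2)])
  also have "mu d n b u (x 1) \<le> r * mu d n b u (x 0)"
    using mu_normalized_map_le[OF weight K] by (simp add: step Tu)
  finally have "mu d n b u (x 0) * (1 - r) \<le> mu d n b (x 1) (x 0)"
    by (simp add: algebra_simps)
  then have "mu d n b u (x 0) \<le> mu d n b (x 1) (x 0) / (1 - r)"
    using r_less_1 by (simp add: le_divide_eq)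
  then have "r ^ k * mu d n b u (x 0) \<le> r ^ k * (mu d n b (x 1) (x 0) / (1 - r))"
    using r_nonneg by (intro mult_left_mono) auto
  moreover have "mu d n b u (x k) \<le> r ^ k * mu d n b u (x 0)"
    using mu_iterate_le[of "\<lambda>_. u"] K(1) Tu by simp
  ultimately show ?thesis by simp
qed

lemma iterate_tendsto_fixed_point:
  assumes u: "u \<in> S_pos d n \<gamma>" and Tu: "normalized_map u = u"
  shows "x \<longlonglongrightarrow> u"
proof (rule S_pos_tendsto[OF iterate_S_pos u b_R_pos])
  have "(\<lambda>k. r ^ k * mu d n b u (x 0)) \<longlonglongrightarrow> 0 * mu d n b u (x 0)"
    using r_nonneg r_less_1 by (intro tendsto_intros LIMSEQ_power_zero) auto
  then have bound: "(\<lambda>k. r ^ k * mu d n b u (x 0)) \<longlonglongrightarrow> 0" by simp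
  show "(\<lambda>k. mu d n b u (x k)) \<longlonglongrightarrow> 0"
  proof (rule tendsto_sandwich[OF always_eventually always_eventually tendsto_const bound])
    show "\<forall>k. 0 \<le> mu d n b u (x k)"
      by (intro allI mu_nonneg[OF b_R_pos S_pos_K_pos[OF u] S_pos_K_pos[OF iterate_S_pos]])
    show "\<forall>k. mu d n b u (x k) \<le> r ^ k * mu d n b u (x 0)"
      using mu_iterate_le[of "\<lambda>_. u"] S_pos_K_pos[OF u] Tu by simp
  qed
qed

text \<open>Completeness of the normalized set is obtained in logarithmic coordinates: consecutive iterates
  differ by at most a multiple of \<open>r^k\<close> in \<open>ln (x k i j)\<close>, so these logarithms form a convergent
  telescoping series. Exponentiating keeps the limit positive.\<close>

lemma iterate_entry_convergent:
  assumes i: "i < d" and j: "j < n i"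
  shows "\<exists>l>0. (\<lambda>k. x k i j) \<longlonglongrightarrow> l"
proof -
  let ?f = "\<lambda>k. ln (x (Suc k) i j) - ln (x k i j)"
  have "summable ?f"
  proof (rule summable_comparison_test')
    show "summable (\<lambda>k. r ^ k * (mu d n b (x 1) (x 0) / b $ i))"
      using r_nonneg r_less_1 by (intro summable_mult2 summable_geometric) simp
    fix k
    have "\<bar>?f k\<bar> \<le> hilbert_dist n (x (Suc k)) (x k) i"
      by (rule ln_diff_le_hilbert_dist[OF iterate_S_pos iterate_S_pos i j])
    also have "\<dots> \<le> mu d n b (x (Suc k)) (x k) / b $ i"
      by (rule hilbert_dist_le_mu[OF b_R_pos S_pos_K_pos S_pos_K_pos i]) (rule iterate_S_pos)+
    also have "\<dots> \<le> (r ^ k * mu d n b (x 1) (x 0)) / b $ i"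
      using mu_iterate_le[of "\<lambda>k. x (Suc k)" k, OF S_pos_K_pos[OF iterate_S_pos] step] b_R_pos i
      by (intro divide_right_mono) (auto simp: R_pos_def less_imp_le)
    finally show "norm (?f k) \<le> r ^ k * (mu d n b (x 1) (x 0) / b $ i)" by simp
  qed
  then obtain s where "(\<lambda>k. \<Sum>m<k. ?f m) \<longlonglongrightarrow> s"
    by (auto simp: summable_iff_convergent convergent_def)
  then have "(\<lambda>k. ln (x k i j) - ln (x 0 i j)) \<longlonglongrightarrow> s"
    using sum_lessThan_telescope[of "\<lambda>k. ln (x k i j)"] by simp
  then have "(\<lambda>k. exp ((ln (x k i j) - ln (x 0 i j)) + ln (x 0 i j))) \<longlonglongrightarrow> exp (s + ln (x 0 i j))"
    by (intro tendsto_intros)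
  then have "(\<lambda>k. x k i j) \<longlonglongrightarrow> exp (s + ln (x 0 i j))"
    using K_pos_D[OF S_pos_K_pos[OF iterate_S_pos] i j] by simp
  then show ?thesis by (intro exI conjI) auto
qed

text \<open>The limit \<open>u\<close> of the iterates lies in the normalized set, and the contraction bound makes
  \<open>x\<^sub>k\<^sub>+\<^sub>1\<close> converge both to \<open>u\<close> and to the image of \<open>u\<close>.\<close>

lemma ex_fixed_point: "\<exists>u \<in> S_pos d n \<gamma>. normalized_map u = u"
proof -
  obtain l where l: "\<And>i j. i < d \<Longrightarrow> j < n i \<Longrightarrow> 0 < l i j \<and> (\<lambda>k. x k i j) \<longlonglongrightarrow> l i j"
    using iterate_entry_convergent by metis
  define u where "u = (\<lambda>i j. if i < d \<and> j < n i then l i j else 0)"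
  have uK: "u \<in> K_pos d n" using l by (intro K_posI) (auto simp: u_def)
  note xK = S_pos_K_pos[OF iterate_S_pos]
  have lim: "(\<lambda>k. x k i j) \<longlonglongrightarrow> u i j" for i j
    using l xK by (cases "i < d \<and> j < n i") (auto simp: u_def K_pos_outside[OF xK])
  have u: "u \<in> S_pos d n \<gamma>"
    by (rule S_pos_closed_in_K_pos[OF iterate_S_pos uK lim])
  have Tu: "normalized_map u \<in> S_pos d n \<gamma>" by (rule normalized_map_S_pos[OF uK])
  have "(\<lambda>k. mu d n b u (x k)) \<longlonglongrightarrow> (\<Sum>i<d. b $ i * 0)"
    unfolding mu_eq_sum_hilbert_dist
    by (intro tendsto_sum tendsto_mult tendsto_const hilbert_dist_tendsto_0[OF xK uK] lim) auto
  then have bound: "(\<lambda>k. r * mu d n b u (x k)) \<longlonglongrightarrow> 0"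
    using tendsto_mult_right_zero by force
  have "(\<lambda>k. mu d n b (normalized_map u) (x (Suc k))) \<longlonglongrightarrow> 0"
  proof (rule tendsto_sandwich[OF always_eventually always_eventually tendsto_const bound])
    show "\<forall>k. 0 \<le> mu d n b (normalized_map u) (x (Suc k))"
      by (intro allI mu_nonneg[OF b_R_pos S_pos_K_pos[OF Tu] xK])
    show "\<forall>k. mu d n b (normalized_map u) (x (Suc k)) \<le> r * mu d n b u (x k)"
      unfolding step by (intro allI mu_normalized_map_le[OF weight uK xK])
  qed
  then have "(\<lambda>k. x (Suc k)) \<longlonglongrightarrow> normalized_map u"
    by (rule S_pos_tendsto[OF iterate_S_pos Tu b_R_pos])
  moreover have "(\<lambda>k. x (Suc k)) \<longlonglongrightarrow> u"
    unfolding tendsto_fun_iff by (intro allI LIMSEQ_Suc[OF lim])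
  ultimately have "\<forall>i j. (\<lambda>k. x (Suc k) i j) \<longlonglongrightarrow> normalized_map u i j"
    "\<forall>i j. (\<lambda>k. x (Suc k) i j) \<longlonglongrightarrow> u i j"
    unfolding tendsto_fun_iff by blast+
  then have "normalized_map u i j = u i j" for i j
    using LIMSEQ_unique by blast
  then have "normalized_map u = u" by (simp add: fun_eq_iff)
  with u show ?thesis by blast
qed

end

end

section \<open>The eigenvector, its uniqueness and the rate of convergence\<close>

theorem theorem2p1:
  fixes d :: nat and n :: "nat \<Rightarrow> nat"
    and \<gamma> :: "nat \<Rightarrow> (nat \<Rightarrow> real) \<Rightarrow> real"
    and F :: "bvec \<Rightarrow> bvec" and A :: "real mat"
  assumes "1 \<le> d" and "\<And>i. i < d \<Longrightarrow> 1 \<le> n i"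
    and "\<And>i. i < d \<Longrightarrow> monotonic_norm (n i) (\<gamma> i)"
    and "F \<in> Hd d n" and "homogeneity_matrix d n F A"
    and "rho A < 1"
  shows "(\<exists>b r. admissible_weight d A b r) \<and>
    (\<exists>!u. normalized_eigenvector d n \<gamma> F u) \<and>
    (\<forall>u x. normalized_eigenvector d n \<gamma> F u \<and> x 0 \<in> S_pos d n \<gamma> \<and>
        (\<forall>k\<ge>1. x k = block_normalize \<gamma> (F (x (k - 1)))) \<longrightarrow>
        x \<longlonglongrightarrow> u \<and>
        (\<forall>b r. admissible_weight d A b r \<longrightarrow>
          (\<forall>k\<ge>1. mu d n b u (x k) \<le> r ^ k / (1 - r) * mu d n b (x 1) (x 0)))) \<and>
    (\<forall>c\<in>R_pos d. (\<exists>\<theta>. eigenvector (transpose_mat A) c \<theta>) \<longrightarrow>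
        admissible_weight d A c (rho A))"
proof -
  interpret multi_homogeneous_map d n \<gamma> F A
    using assms(2-5) by unfold_locales auto
  have d: "0 < d" using assms(1) by simp
  have r0: "0 \<le> r" if "admissible_weight d A b r" for b r
    using that rho_nonneg[OF A_carrier d] by (simp add: admissible_weight_def)
  obtain b r where w: "admissible_weight d A b r"
    using ex_admissible_weight[OF A_carrier d assms(6) A_nonneg] by blast
  \<comment> \<open>The orbit starts after one step, because the all-ones vector itself need not be normalized.\<close>
  define z where "z = (\<lambda>k. (normalized_map ^^ Suc k) (block_one d n))"
  have z0: "z 0 \<in> S_pos d n \<gamma>" by (simp add: z_def normalized_map_S_pos one_K_pos)
  have zs: "z (Suc k) = normalized_map (z k)" for k by (simp add: z_def)
  obtain u where u: "u \<in> S_pos d n \<gamma>" "normalized_map u = u"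
    using ex_fixed_point[OF w r0[OF w] z0 zs] by blast
  \<comment> \<open>A fixed point is a constant orbit, and every orbit converges to \<open>u\<close>.\<close>
  have unique: "v = u" if v: "v \<in> S_pos d n \<gamma>" "normalized_map v = v" for v
  proof -
    have "(\<lambda>_::nat. v) \<longlonglongrightarrow> u"
      using v by (intro iterate_tendsto_fixed_point[OF w r0[OF w] _ _ u]) auto
    then have "\<forall>i j. (\<lambda>_::nat. v i j) \<longlonglongrightarrow> u i j" unfolding tendsto_fun_iff .
    then show ?thesis unfolding LIMSEQ_const_iff by (simp add: fun_eq_iff)
  qed
  have "\<exists>!u. normalized_eigenvector d n \<gamma> F u"
    unfolding normalized_eigenvector_iff using u unique by blast
  moreover have "x \<longlonglongrightarrow> v \<and>
        (\<forall>b r. admissible_weight d A b r \<longrightarrow>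
          (\<forall>k\<ge>1. mu d n b v (x k) \<le> r ^ k / (1 - r) * mu d n b (x 1) (x 0)))"
    if "normalized_eigenvector d n \<gamma> F v" and x0: "x 0 \<in> S_pos d n \<gamma>"
      and "\<forall>k\<ge>1. x k = block_normalize \<gamma> (F (x (k - 1)))" for v x
  proof -
    have v: "v \<in> S_pos d n \<gamma>" "normalized_map v = v" using that(1) by (simp_all add: normalized_eigenvector_iff)
    have xs: "x (Suc k) = normalized_map (x k)" for k using that(3) by (simp add: normalized_map_def)
    show ?thesis
      using iterate_tendsto_fixed_point[OF w r0[OF w] x0 xs v] mu_fixed_point_le[OF _ r0 x0 xs v]
      by blast
  qed
  ultimately show ?thesis
    using w admissible_weight_left_eigenvector[OF A_carrier d A_nonneg assms(6)] by blast
qed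

end
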